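(* Let $\tau$ be a finite relational vocabulary, let $\mathcal{Q}$ be a finite set of generalized quantifiers of arbitrary finite width $k\in\mathbb{Z}_+$ and type $\mathbf{n}\in\mathbb{Z}_+^k$, let $\mathcal{A}$ and $\mathcal{B}$ be classes of $\tau$-pairs, and let $s\in\mathbb{Z}_+$. Then Player $\mathbb{I}$ has a winning strategy in the $\mathrm{FS}_s\{\mathcal{Q}\}(\mathcal{A},\mathcal{B})$-game if and only if $\mathcal{A}$ and $\mathcal{B}$ are separable by a formula of $\mathrm{FO}(\mathcal{Q})$ of size $\leq s$.
   Context: **Logic.** $\tau$ is a finite set of relation symbols with arities in $\mathbb{N}$. A $\tau$-model $\mathfrak{A}$ has a non-empty, possibly infinite domain $A$ and a relation $R^{\mathfrak{A}}\subseteq A^k$ for each $k$-ary $R\in\tau$. $\mathrm{VAR}$ is a countably infinite set of variables. An assignment over $\mathfrak{A}$ is a (possibly empty) function $f:X\to A$ with $X\subseteq\mathrm{VAR}$ finite. For $\mathbf{x}\in\mathrm{VAR}^n$, a tuple $\mathbf{a}\in A^n$ *respects $\mathbf{x}$-repetitions* if $\mathbf{x}(i)=\mathbf{x}(j)$ implies $\mathbf{a}(i)=\mathbf{a}(j)$; a set of tuples does so if all its members do. For such $\mathbf{a}$, $f\frac{\mathbf{a}}{\mathbf{x}}$ is the assignment with domain $\mathrm{dom}(f)\cup\{\mathbf{x}(1),\dots,\mathbf{x}(n)\}$ mapping $\mathbf{x}(i)$ to $\mathbf{a}(i)$ and agreeing with $f$ elsewhere. A generalized quantifier of width $k$ and type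 $\mathbf{n}$ is an isomorphism-closed class $Q$ of structures $(D,P_1,\dots,P_k)$ with $P_j\subseteq D^{\mathbf{n}(j)}$. $\mathrm{FO}(\mathcal{Q})$ is built from the atomic formulas $x=y$ and $R(x_1,\dots,x_k)$ using $\neg$, $\land$ and $Q\mathbf{x}_1,\dots,\mathbf{x}_k(\varphi_1,\dots,\varphi_k)$ for $Q\in\mathcal{Q}$ of width $k$ and type $\mathbf{n}$, $\mathbf{x}_j\in\mathrm{VAR}^{\mathbf{n}(j)}$ (the variables of $\mathbf{x}_j$ are bound in $\varphi_j$). $\mathcal{Q}$ need not contain $\exists$ or $\forall$. Semantics: atoms and connectives as usual, and $\mathfrak{A},f\models Q\mathbf{x}_1,\dots,\mathbf{x}_k(\varphi_1,\dots,\varphi_k)$ iff $(A,\|\varphi_1\|^{\mathfrak{A},f}_{\mathbf{x}_1},\dots,\|\varphi_k\|^{\mathfrak{A},f}_{\mathbf{x}_k})\in Q$, where $\|\varphi\|^{\mathfrak{A},f}_{\mathbf{x}}=\{\mathbf{a}\mid\mathbf{a}\text{ respects }\mathbf{x}\text{-repetitions and }\mathfrak{A},f\frac{\mathbf{a}}{\mathbf{x}}\models\varphi\}$; here $\mathrm{dom}(f)$ contains all free variables of the formula being evaluated. **Size.** $s(\varphi)=1$ for atomic $\varphi$; $s(\neg\varphi)=s(\varphi)+1$; $s(\varphi\land\psi)=s(\varphi)+s(\psi)$; $s(Q\mathbf{x}_1,\dots,\mathbf{x}_k(\varphi_1,\dots,\varphi_k))=s(\varphi_1)+\dots+s(\varphi_k)+1$.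 **Separability.** A $\tau$-pair is a pair $(\mathfrak{A},f)$ with $\mathfrak{A}$ a $\tau$-model and $f$ an assignment over $\mathfrak{A}$. A formula $\varphi$ separates classes $\mathcal{A},\mathcal{B}$ of $\tau$-pairs (possibly empty) if $\mathfrak{A},f\models\varphi$ for all $(\mathfrak{A},f)\in\mathcal{A}$ and $\mathfrak{B},g\not\models\varphi$ for all $(\mathfrak{B},g)\in\mathcal{B}$. **The game.** $\mathrm{FS}_s\{\mathcal{Q}\}(\mathcal{A},\mathcal{B})$ is a two-player game starting in position $(s,\mathcal{A},\mathcal{B})$. A round from position $(s_i,\mathcal{A}_i,\mathcal{B}_i)$ goes as follows. 1. If some atomic formula separates $\mathcal{A}_i$ and $\mathcal{B}_i$, Player $\mathbb{I}$ wins. 2. Otherwise, if $s_i=1$, Player $\mathbb{II}$ wins. 3. Otherwise Player $\mathbb{I}$ chooses one of: (a) *Swap.* The next position is $(s_i-1,\mathcal{B}_i,\mathcal{A}_i)$. (b) *Right splitting.* Player $\mathbb{I}$ chooses $u,v\in\mathbb{Z}_+$ with $u+v=s_i$ and (possibly overlapping) $\mathcal{C},\mathcal{D}\subseteq\mathcal{B}_i$ with $\mathcal{C}\cup\mathcal{D}=\mathcal{B}_i$; Player $\mathbb{II}$ chooses whether the next position is $(u,\mathcal{A}_i,\mathcal{C})$ or $(v,\mathcal{A}_i,\mathcal{D})$. (c) *Supplementing.* Player $\mathbb{I}$ chooses $Q\in\mathcal{Q}$ of width $k$ and type $\mathbf{n}$, tuples $\mathbf{x}_j\in\mathrm{VAR}^{\mathbf{n}(j)}$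 ($1\le j\le k$), numbers $u_1,\dots,u_k\in\mathbb{Z}_+$ with $u_1+\dots+u_k=s_i-1$, and functions $P_1,\dots,P_k$, each $P_j$ assigning to every $(\mathfrak{C},h)\in\mathcal{A}_i\cup\mathcal{B}_i$ a set $P_j(\mathfrak{C},h)\subseteq C^{\mathbf{n}(j)}$ respecting $\mathbf{x}_j$-repetitions, such that $(A,P_1(\mathfrak{A},f),\dots,P_k(\mathfrak{A},f))\in Q$ for all $(\mathfrak{A},f)\in\mathcal{A}_i$ and $(B,P_1(\mathfrak{B},g),\dots,P_k(\mathfrak{B},g))\notin Q$ for all $(\mathfrak{B},g)\in\mathcal{B}_i$ (if no such functions exist, this move is unavailable). Player $\mathbb{II}$ chooses $j\in\{1,\dots,k\}$ and the next position is $(u_j,\mathcal{C}_j^+,\mathcal{C}_j^-)$, where $\mathcal{C}_j^+=\{(\mathfrak{C},h\frac{\mathbf{v}}{\mathbf{x}_j})\mid(\mathfrak{C},h)\in\mathcal{A}_i\cup\mathcal{B}_i,\ \mathbf{v}\in P_j(\mathfrak{C},h)\}$ and $\mathcal{C}_j^-=\{(\mathfrak{C},h\frac{\mathbf{v}}{\mathbf{x}_j})\mid(\mathfrak{C},h)\in\mathcal{A}_i\cup\mathcal{B}_i,\ \mathbf{v}\in C^{\mathbf{n}(j)}\setminus P_j(\mathfrak{C},h)\text{ respects }\mathbf{x}_j\text{-repetitions}\}$.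
   Formalization: If formulas are evaluated only where all free variables are assigned, the claim fails for mixed domains, so all assignments in A and B share one domain there; arbitrary A, B are covered with atoms on unassigned variables counted false. Classes are sets of pairs over one arbitrary type. *)

theory Defs
  imports Main
begin

(* VAR is the type nat.  A vocabulary is a partial map from symbols to arities. *)

type_synonym var = nat
type_synonym 'r vocabulary = "'r \<rightharpoonup> nat"

definition tuples :: "'a set \<Rightarrow> nat \<Rightarrow> 'a list set" where
  "tuples A n = {as. length as = n \<and> set as \<subseteq> A}"

datatype ('a, 'r) model = Model (domain: "'a set") (interp: "'r \<Rightarrow> 'a list set")

(* Symbols outside the vocabulary get the empty relation, so that a model carries
   no information beyond its vocabulary. *)
definition is_model :: "'r vocabulary \<Rightarrow> ('a, 'r) model \<Rightarrow> bool" where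
  "is_model \<tau> M \<longleftrightarrow> domain M \<noteq> {} \<and>
     (\<forall>R. case \<tau> R of Some k \<Rightarrow> interp M R \<subseteq> tuples (domain M) k
                   | None \<Rightarrow> interp M R = {})"

type_synonym 'a assignment = "var \<rightharpoonup> 'a"
type_synonym ('a, 'r) pair = "('a, 'r) model \<times> 'a assignment"

definition is_assignment :: "('a, 'r) model \<Rightarrow> 'a assignment \<Rightarrow> bool" where
  "is_assignment M f \<longleftrightarrow> finite (dom f) \<and> ran f \<subseteq> domain M"

definition pairs :: "'r vocabulary \<Rightarrow> ('a, 'r) pair set" where
  "pairs \<tau> = {(M, f). is_model \<tau> M \<and> is_assignment M f}"

definition respects_repetitions :: "'a list \<Rightarrow> var list \<Rightarrow> bool" where
  "respects_repetitions as xs \<longleftrightarrow>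
     (\<forall>i < length xs. \<forall>j < length xs. xs ! i = xs ! j \<longrightarrow> as ! i = as ! j)"

definition respecting :: "'a set \<Rightarrow> var list \<Rightarrow> 'a list set" where
  "respecting A xs = {as \<in> tuples A (length xs). respects_repetitions as xs}"

(* The type is stored next to the class because an empty class does not determine it.
   The width is the length of the type. *)
datatype 'a quantifier =
  Quantifier (qtype: "nat list") (qclass: "('a set \<times> 'a list set list) set")

definition is_quantifier :: "'a quantifier \<Rightarrow> bool" where
  "is_quantifier Q \<longleftrightarrow>
     length (qtype Q) \<ge> 1 \<and> (\<forall>n \<in> set (qtype Q). n \<ge> 1) \<and>
     (\<forall>(D, Ps) \<in> qclass Q. list_all2 (\<lambda>P n. P \<subseteq> tuples D n) Ps (qtype Q)) \<and>
     (\<forall>(D, Ps) \<in> qclass Q. \<forall>h E. bij_betw h D E \<longrightarrow>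
        (E, map (\<lambda>P. map h ` P) Ps) \<in> qclass Q)"

datatype ('a, 'r) fm =
    Eq var var
  | Rel 'r "var list"
  | Neg "('a, 'r) fm"
  | Conj "('a, 'r) fm" "('a, 'r) fm"
  | Quant "'a quantifier" "(var list \<times> ('a, 'r) fm) list"

fun is_atom :: "('a, 'r) fm \<Rightarrow> bool" where
  "is_atom (Eq x y) = True"
| "is_atom (Rel R xs) = True"
| "is_atom _ = False"

inductive_set FO :: "'r vocabulary \<Rightarrow> 'a quantifier set \<Rightarrow> ('a, 'r) fm set"
  for \<tau> :: "'r vocabulary" and \<Q> :: "'a quantifier set" where
  Eq: "Eq x y \<in> FO \<tau> \<Q>"
| Rel: "\<tau> R = Some (length xs) \<Longrightarrow> Rel R xs \<in> FO \<tau> \<Q>"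
| Neg: "\<phi> \<in> FO \<tau> \<Q> \<Longrightarrow> Neg \<phi> \<in> FO \<tau> \<Q>"
| Conj: "\<phi> \<in> FO \<tau> \<Q> \<Longrightarrow> \<psi> \<in> FO \<tau> \<Q> \<Longrightarrow> Conj \<phi> \<psi> \<in> FO \<tau> \<Q>"
| Quant: "Q \<in> \<Q> \<Longrightarrow> map (length \<circ> fst) bs = qtype Q \<Longrightarrow>
    (\<And>xs \<phi>. (xs, \<phi>) \<in> set bs \<Longrightarrow> \<phi> \<in> FO \<tau> \<Q>) \<Longrightarrow> Quant Q bs \<in> FO \<tau> \<Q>"

fun free_vars :: "('a, 'r) fm \<Rightarrow> var set" where
  "free_vars (Eq x y) = {x, y}"
| "free_vars (Rel R xs) = set xs"
| "free_vars (Neg \<phi>) = free_vars \<phi>"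
| "free_vars (Conj \<phi> \<psi>) = free_vars \<phi> \<union> free_vars \<psi>"
| "free_vars (Quant Q bs) = (\<Union>(xs, \<phi>) \<in> set bs. free_vars \<phi> - set xs)"

fun fm_size :: "('a, 'r) fm \<Rightarrow> nat" where
  "fm_size (Eq x y) = 1"
| "fm_size (Rel R xs) = 1"
| "fm_size (Neg \<phi>) = fm_size \<phi> + 1"
| "fm_size (Conj \<phi> \<psi>) = fm_size \<phi> + fm_size \<psi>"
| "fm_size (Quant Q bs) = sum_list (map (\<lambda>(xs, \<phi>). fm_size \<phi>) bs) + 1"

(* The usual semantics when dom f contains the free variables of the formula.  To make
   satisfaction total, an atom with a variable outside dom f counts as false. *)
fun sat :: "('a, 'r) model \<Rightarrow> 'a assignment \<Rightarrow> ('a, 'r) fm \<Rightarrow> bool" where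
  "sat M f (Eq x y) \<longleftrightarrow> x \<in> dom f \<and> y \<in> dom f \<and> f x = f y"
| "sat M f (Rel R xs) \<longleftrightarrow> set xs \<subseteq> dom f \<and> map (the \<circ> f) xs \<in> interp M R"
| "sat M f (Neg \<phi>) \<longleftrightarrow> \<not> sat M f \<phi>"
| "sat M f (Conj \<phi> \<psi>) \<longleftrightarrow> sat M f \<phi> \<and> sat M f \<psi>"
| "sat M f (Quant Q bs) \<longleftrightarrow>
     (domain M,
      map (\<lambda>(xs, \<phi>). {as \<in> respecting (domain M) xs. sat M (f(xs [\<mapsto>] as)) \<phi>}) bs)
     \<in> qclass Q"

type_synonym ('a, 'r) separation =
  "('a, 'r) fm \<Rightarrow> ('a, 'r) pair set \<Rightarrow> ('a, 'r) pair set \<Rightarrow> bool"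

definition separates :: "('a, 'r) separation" where
  "separates \<phi> \<A> \<B> \<longleftrightarrow> (\<forall>(M, f) \<in> \<A>. sat M f \<phi>) \<and> (\<forall>(M, f) \<in> \<B>. \<not> sat M f \<phi>)"

(* Separation in which the formula may only be evaluated at assignments whose domain
   contains all its free variables. *)
definition separates_strictly :: "('a, 'r) separation" where
  "separates_strictly \<phi> \<A> \<B> \<longleftrightarrow>
     (\<forall>(M, f) \<in> \<A> \<union> \<B>. free_vars \<phi> \<subseteq> dom f) \<and> separates \<phi> \<A> \<B>"

definition separable_within ::
  "('a, 'r) separation \<Rightarrow> 'r vocabulary \<Rightarrow> 'a quantifier set \<Rightarrow> nat \<Rightarrow>
   ('a, 'r) pair set \<Rightarrow> ('a, 'r) pair set \<Rightarrow> bool" where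
  "separable_within sep \<tau> \<Q> s \<A> \<B> \<longleftrightarrow> (\<exists>\<phi> \<in> FO \<tau> \<Q>. fm_size \<phi> \<le> s \<and> sep \<phi> \<A> \<B>)"

definition common_domain :: "('a, 'r) pair set \<Rightarrow> bool" where
  "common_domain \<C> \<longleftrightarrow> (\<exists>X. \<forall>(M, f) \<in> \<C>. dom f = X)"

type_synonym ('a, 'r) position = "nat \<times> ('a, 'r) pair set \<times> ('a, 'r) pair set"

datatype ('a, 'r) move =
    Swap
  | Split nat nat "('a, 'r) pair set" "('a, 'r) pair set"
  | Supplement "'a quantifier" "var list list" "nat list"
      "(('a, 'r) pair \<Rightarrow> 'a list set) list"

fun legal :: "'a quantifier set \<Rightarrow> ('a, 'r) position \<Rightarrow> ('a, 'r) move \<Rightarrow> bool" where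
  "legal \<Q> (s, \<A>, \<B>) Swap = True"
| "legal \<Q> (s, \<A>, \<B>) (Split u v \<C> \<D>) \<longleftrightarrow>
     u \<ge> 1 \<and> v \<ge> 1 \<and> u + v = s \<and> \<C> \<union> \<D> = \<B>"
| "legal \<Q> (s, \<A>, \<B>) (Supplement Q xss us Ps) \<longleftrightarrow>
     Q \<in> \<Q> \<and> map length xss = qtype Q \<and>
     length us = length (qtype Q) \<and> (\<forall>u \<in> set us. u \<ge> 1) \<and> sum_list us = s - 1 \<and>
     length Ps = length (qtype Q) \<and>
     (\<forall>j < length Ps. \<forall>(C, h) \<in> \<A> \<union> \<B>. (Ps ! j) (C, h) \<subseteq> respecting (domain C) (xss ! j)) \<and>
     (\<forall>(M, f) \<in> \<A>. (domain M, map (\<lambda>P. P (M, f)) Ps) \<in> qclass Q) \<and>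
     (\<forall>(M, f) \<in> \<B>. (domain M, map (\<lambda>P. P (M, f)) Ps) \<notin> qclass Q)"

(* The positions among which Player II chooses after a move of Player I. *)
fun successors :: "('a, 'r) position \<Rightarrow> ('a, 'r) move \<Rightarrow> ('a, 'r) position set" where
  "successors (s, \<A>, \<B>) Swap = {(s - 1, \<B>, \<A>)}"
| "successors (s, \<A>, \<B>) (Split u v \<C> \<D>) = {(u, \<A>, \<C>), (v, \<A>, \<D>)}"
| "successors (s, \<A>, \<B>) (Supplement Q xss us Ps) =
     {(us ! j,
       {(C, h(xss ! j [\<mapsto>] as)) | C h as. (C, h) \<in> \<A> \<union> \<B> \<and> as \<in> (Ps ! j) (C, h)},
       {(C, h(xss ! j [\<mapsto>] as)) | C h as. (C, h) \<in> \<A> \<union> \<B> \<and>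
          as \<in> respecting (domain C) (xss ! j) - (Ps ! j) (C, h)}) | j. j < length Ps}"

fun won_by_I :: "('a, 'r) separation \<Rightarrow> 'r vocabulary \<Rightarrow> ('a, 'r) position \<Rightarrow> bool" where
  "won_by_I sep \<tau> (s, \<A>, \<B>) \<longleftrightarrow> (\<exists>\<phi> \<in> FO \<tau> {}. is_atom \<phi> \<and> sep \<phi> \<A> \<B>)"

fun won_by_II :: "('a, 'r) separation \<Rightarrow> 'r vocabulary \<Rightarrow> ('a, 'r) position \<Rightarrow> bool" where
  "won_by_II sep \<tau> (s, \<A>, \<B>) \<longleftrightarrow> \<not> won_by_I sep \<tau> (s, \<A>, \<B>) \<and> s = 1"

(* A strategy maps the non-empty list of positions visited so far to a move. *)
type_synonym ('a, 'r) strategy = "('a, 'r) position list \<Rightarrow> ('a, 'r) move"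

inductive play ::
  "('a, 'r) separation \<Rightarrow> 'r vocabulary \<Rightarrow> 'a quantifier set \<Rightarrow> ('a, 'r) strategy \<Rightarrow>
   ('a, 'r) position \<Rightarrow> ('a, 'r) position list \<Rightarrow> bool"
  for sep \<tau> \<Q> \<sigma> p where
  start: "play sep \<tau> \<Q> \<sigma> p [p]"
| step: "play sep \<tau> \<Q> \<sigma> p ps \<Longrightarrow>
    \<not> won_by_I sep \<tau> (last ps) \<Longrightarrow> \<not> won_by_II sep \<tau> (last ps) \<Longrightarrow>
    legal \<Q> (last ps) (\<sigma> ps) \<Longrightarrow> q \<in> successors (last ps) (\<sigma> ps) \<Longrightarrow>
    play sep \<tau> \<Q> \<sigma> p (ps @ [q])"

(* Every play is finite because the number in the position decreases.  A play that stops
   because the strategy proposes an illegal move is maximal and not won by Player I. *)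
definition winning_strategy ::
  "('a, 'r) separation \<Rightarrow> 'r vocabulary \<Rightarrow> 'a quantifier set \<Rightarrow> ('a, 'r) position \<Rightarrow>
   ('a, 'r) strategy \<Rightarrow> bool" where
  "winning_strategy sep \<tau> \<Q> p \<sigma> \<longleftrightarrow>
     (\<forall>ps. play sep \<tau> \<Q> \<sigma> p ps \<and> (\<nexists>q. play sep \<tau> \<Q> \<sigma> p (ps @ [q])) \<longrightarrow>
        won_by_I sep \<tau> (last ps))"

end

theory Submission
  imports Defs
begin

text \<open>
A winning strategy of Player I on a position is a separating formula read from the root towards
the atoms. Each move corresponds to the outermost connective: swapping to \<open>Neg\<close>, splitting to
\<open>Conj\<close>, supplementing to \<open>Quant\<close>; Player II picks the immediate subformula to be examined next,
and the number in the position is the size available for that subformula.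

Strategies are first eliminated: Player I has a winning strategy exactly on the positions of the
least set \<open>winning_position\<close> closed under ``some legal move leads only into the set''
(\<open>winning_strategy_iff\<close>). One direction uses that the number decreases along a play, the other
that Player II always has a successor to choose, because quantifiers have positive width.
Rule induction over this set then builds a formula
(\<open>separable_if_winning_position\<close>), and induction over the formula produces the moves
(\<open>winning_position_if_separates\<close>).

Ordinary and strict separation are treated together. The additional point for strict separation
is that the free variables of the formula which is built must be assigned at all pairs, although
the formulas supplied by the successor positions are controlled only on the pairs of these
positions. If all assignments share one domain, a single pair controls the variables. If a position
reached by splitting has no pair, then the formula of the other one alone is sufficient.
\<close>

section \<open>Plain and strict separation together\<close>

definition separates_in_mode :: "bool \<Rightarrow> ('a, 'r) separation" where
  "separates_in_mode strict \<phi> \<A> \<B> \<longleftrightarrow>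
     (strict \<longrightarrow> (\<forall>(M, f) \<in> \<A> \<union> \<B>. free_vars \<phi> \<subseteq> dom f)) \<and> separates \<phi> \<A> \<B>"

lemma separates_eq_mode: "separates = separates_in_mode False"
  by (intro ext) (simp add: separates_in_mode_def)

lemma separates_strictly_eq_mode: "separates_strictly = separates_in_mode True"
  by (intro ext) (simp add: separates_in_mode_def separates_strictly_def)

lemma separates_iff:
  "separates \<phi> \<A> \<B> \<longleftrightarrow>
     (\<forall>M f. (M, f) \<in> \<A> \<longrightarrow> sat M f \<phi>) \<and> (\<forall>M f. (M, f) \<in> \<B> \<longrightarrow> \<not> sat M f \<phi>)"
  by (simp add: separates_def Ball_def)

lemma separates_in_mode_iff:
  "separates_in_mode strict \<phi> \<A> \<B> \<longleftrightarrow>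
     (strict \<longrightarrow> (\<forall>M f. (M, f) \<in> \<A> \<union> \<B> \<longrightarrow> free_vars \<phi> \<subseteq> dom f)) \<and> separates \<phi> \<A> \<B>"
  by (simp add: separates_in_mode_def Ball_def)

lemma separates_in_modeI:
  assumes "\<And>M f. strict \<Longrightarrow> (M, f) \<in> \<A> \<union> \<B> \<Longrightarrow> free_vars \<phi> \<subseteq> dom f"
    and "\<And>M f. (M, f) \<in> \<A> \<Longrightarrow> sat M f \<phi>"
    and "\<And>M f. (M, f) \<in> \<B> \<Longrightarrow> \<not> sat M f \<phi>"
  shows "separates_in_mode strict \<phi> \<A> \<B>"
  using assms by (simp add: separates_in_mode_iff separates_iff)

lemma separates_in_modeD:
  assumes "separates_in_mode strict \<phi> \<A> \<B>"
  shows "strict \<Longrightarrow> (M, f) \<in> \<A> \<union> \<B> \<Longrightarrow> free_vars \<phi> \<subseteq> dom f"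
    and "(M, f) \<in> \<A> \<Longrightarrow> sat M f \<phi>"
    and "(M, f) \<in> \<B> \<Longrightarrow> \<not> sat M f \<phi>"
  using assms unfolding separates_in_mode_iff separates_iff by blast+

lemma common_domainI:
  "(\<And>M f. (M, f) \<in> \<C> \<Longrightarrow> dom f = X) \<Longrightarrow> common_domain \<C>"
  unfolding common_domain_def by (intro exI[of _ X]) auto

lemma common_domainE:
  assumes "common_domain \<C>"
  obtains X where "\<And>M f. (M, f) \<in> \<C> \<Longrightarrow> dom f = X"
  using assms unfolding common_domain_def by (elim exE) fast

lemma common_domain_subset: "common_domain \<C> \<Longrightarrow> \<D> \<subseteq> \<C> \<Longrightarrow> common_domain \<D>"
  unfolding common_domain_def by (meson subsetD)

lemma fm_size_ge_1: "fm_size \<phi> \<ge> 1"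
  by (induction \<phi>) auto

lemma FO_mono: "\<phi> \<in> FO \<tau> \<Q> \<Longrightarrow> \<Q> \<subseteq> \<Q>' \<Longrightarrow> \<phi> \<in> FO \<tau> \<Q>'"
  by (induction rule: FO.induct) (auto intro: FO.intros)

lemma fm_size_atom: "is_atom \<phi> \<Longrightarrow> fm_size \<phi> = 1"
  by (cases \<phi>) auto

section \<open>Winning positions\<close>

inductive winning_position ::
  "('a, 'r) separation \<Rightarrow> 'r vocabulary \<Rightarrow> 'a quantifier set \<Rightarrow> ('a, 'r) position \<Rightarrow> bool"
  for sep \<tau> \<Q> where
  won: "won_by_I sep \<tau> p \<Longrightarrow> winning_position sep \<tau> \<Q> p"
| move: "\<not> won_by_II sep \<tau> p \<Longrightarrow> legal \<Q> p m \<Longrightarrow>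
    (\<And>q. q \<in> successors p m \<Longrightarrow> winning_position sep \<tau> \<Q> q) \<Longrightarrow> winning_position sep \<tau> \<Q> p"

lemma successors_nonempty:
  assumes "\<forall>Q \<in> \<Q>. is_quantifier Q" and "legal \<Q> p m"
  shows "successors p m \<noteq> {}"
proof (cases p)
  case (fields s \<A> \<B>)
  show ?thesis
  proof (cases m)
    case (Supplement Q xss us Ps)
    then have "is_quantifier Q" and "length Ps = length (qtype Q)"
      using assms fields by auto
    then have "0 < length Ps" by (auto simp: is_quantifier_def)
    then show ?thesis using fields Supplement by auto
  qed (use fields in auto)
qed

text \<open>Swapping at number \<open>0\<close> would leave the number unchanged, and at number \<open>1\<close> the play is over;
the lower bound in the conclusion keeps a play away from \<open>0\<close>.\<close>

lemma successors_decrease: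
  assumes "legal \<Q> p m" and "q \<in> successors p m" and "2 \<le> fst p"
  shows "1 \<le> fst q \<and> fst q < fst p"
proof -
  obtain s \<A> \<B> where p: "p = (s, \<A>, \<B>)" by (cases p)
  show ?thesis
  proof (cases m)
    case (Supplement Q xss us Ps)
    then obtain j where j: "j < length us" "fst q = us ! j"
      using assms p by auto
    have "us ! j \<in> set us" using j by simp
    moreover have "us ! j \<le> sum_list us" using j by (simp add: elem_le_sum_list)
    ultimately show ?thesis using assms p Supplement j by auto
  qed (use assms p in auto)
qed

lemma fst_ge_2_if_not_over:
  "\<not> won_by_I sep \<tau> p \<Longrightarrow> \<not> won_by_II sep \<tau> p \<Longrightarrow> 1 \<le> fst p \<Longrightarrow> 2 \<le> fst p"
  by (cases p) auto

text \<open>In a winning position that is not yet won a move into winning positions can be chosen from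
the position alone, so a memoryless strategy suffices.\<close>

lemma winning_strategy_if_winning_position:
  assumes Q: "\<forall>Q \<in> \<Q>. is_quantifier Q" and win: "winning_position sep \<tau> \<Q> p"
  shows "\<exists>\<sigma>. winning_strategy sep \<tau> \<Q> p \<sigma>"
proof -
  let ?good = "\<lambda>p m. legal \<Q> p m \<and> (\<forall>q \<in> successors p m. winning_position sep \<tau> \<Q> q)"
  define \<sigma> where "\<sigma> ps = (SOME m. ?good (last ps) m)" for ps
  have good: "?good (last ps) (\<sigma> ps)"
    if "winning_position sep \<tau> \<Q> (last ps)" "\<not> won_by_I sep \<tau> (last ps)" for ps
  proof -
    have "\<exists>m. ?good (last ps) m"
      using that by (meson winning_position.cases)
    then show ?thesis unfolding \<sigma>_def by (rule someI_ex)
  qed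
  have inv: "winning_position sep \<tau> \<Q> (last ps)" if "play sep \<tau> \<Q> \<sigma> p ps" for ps
    using that
  proof induction
    case start
    then show ?case using win by simp
  next
    case (step ps q)
    then show ?case using good[of ps] by simp
  qed
  have "winning_strategy sep \<tau> \<Q> p \<sigma>"
    unfolding winning_strategy_def
  proof (intro allI impI)
    fix ps
    assume max: "play sep \<tau> \<Q> \<sigma> p ps \<and> (\<nexists>q. play sep \<tau> \<Q> \<sigma> p (ps @ [q]))"
    show "won_by_I sep \<tau> (last ps)"
    proof (rule ccontr)
      assume n: "\<not> won_by_I sep \<tau> (last ps)"
      have w: "winning_position sep \<tau> \<Q> (last ps)" using inv max by blast
      then have "\<not> won_by_II sep \<tau> (last ps)"
        using n by (auto elim: winning_position.cases)
      moreover have legal: "legal \<Q> (last ps) (\<sigma> ps)" using good[OF w n] by blast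
      moreover obtain q where "q \<in> successors (last ps) (\<sigma> ps)"
        using successors_nonempty[OF Q legal] by blast
      ultimately have "play sep \<tau> \<Q> \<sigma> p (ps @ [q])"
        using max n by (blast intro: play.step)
      then show False using max by blast
    qed
  qed
  then show ?thesis by blast
qed

lemma play_nonempty: "play sep \<tau> \<Q> \<sigma> p ps \<Longrightarrow> ps \<noteq> []"
  by (induction rule: play.induct) auto

text \<open>Every position reached by a winning strategy is a winning position. This is seen by induction
on the number in the position: a play that is not yet won is not maximal, so the strategy proposes
a legal move, and every answer of Player II prolongs the play.\<close>

lemma winning_position_if_play:
  assumes win: "winning_strategy sep \<tau> \<Q> p \<sigma>"
  shows "play sep \<tau> \<Q> \<sigma> p ps \<Longrightarrow> 1 \<le> fst (last ps) \<Longrightarrow> winning_position sep \<tau> \<Q> (last ps)"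
proof (induction "fst (last ps)" arbitrary: ps rule: less_induct)
  case less
  show ?case
  proof (cases "won_by_I sep \<tau> (last ps)")
    case True
    then show ?thesis by (rule winning_position.won)
  next
    case False
    then obtain q where "play sep \<tau> \<Q> \<sigma> p (ps @ [q])"
      using win less.prems unfolding winning_strategy_def by blast
    then have nII: "\<not> won_by_II sep \<tau> (last ps)" and legal: "legal \<Q> (last ps) (\<sigma> ps)"
      using play_nonempty[OF less.prems(1)] by (auto elim: play.cases)
    have ge2: "2 \<le> fst (last ps)"
      using fst_ge_2_if_not_over[OF False nII less.prems(2)] .
    show ?thesis
    proof (rule winning_position.move[OF nII legal])
      fix q assume q: "q \<in> successors (last ps) (\<sigma> ps)"
      have "play sep \<tau> \<Q> \<sigma> p (ps @ [q])"
        using play.step[OF less.prems(1) False nII legal q] .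
      then show "winning_position sep \<tau> \<Q> q"
        using less.hyps[of "ps @ [q]"] successors_decrease[OF legal q ge2] by simp
    qed
  qed
qed

lemma winning_strategy_iff:
  assumes "\<forall>Q \<in> \<Q>. is_quantifier Q" and "1 \<le> fst p"
  shows "(\<exists>\<sigma>. winning_strategy sep \<tau> \<Q> p \<sigma>) \<longleftrightarrow> winning_position sep \<tau> \<Q> p"
proof
  assume "\<exists>\<sigma>. winning_strategy sep \<tau> \<Q> p \<sigma>"
  then obtain \<sigma> where "winning_strategy sep \<tau> \<Q> p \<sigma>" ..
  from winning_position_if_play[OF this play.start] show "winning_position sep \<tau> \<Q> p"
    using assms(2) by simp
qed (rule winning_strategy_if_winning_position[OF assms(1)])

section \<open>From winning positions to formulas\<close>

lemma separable_if_won_by_I: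
  assumes "won_by_I sep \<tau> (s, \<A>, \<B>)" and "1 \<le> s"
  shows "separable_within sep \<tau> \<Q> s \<A> \<B>"
proof -
  obtain \<phi> where "\<phi> \<in> FO \<tau> {}" "is_atom \<phi>" "sep \<phi> \<A> \<B>" using assms(1) by auto
  then show ?thesis
    using FO_mono[of \<phi> \<tau> "{}" \<Q>] fm_size_atom[of \<phi>] assms(2)
    unfolding separable_within_def by (intro bexI[of _ \<phi>]) auto
qed

lemma separates_Neg:
  "separates_in_mode strict (Neg \<phi>) \<A> \<B> \<longleftrightarrow> separates_in_mode strict \<phi> \<B> \<A>"
  by (simp add: separates_in_mode_def separates_def Un_commute conj_commute)

text \<open>When \<open>\<A> \<union> \<C>\<close> is empty, strict separation does not restrict the variables of \<open>\<phi>\<close>, which may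
thus be unassigned at pairs in \<open>\<D>\<close>. This is why the conjunction cannot be taken in all cases.\<close>

lemma separable_split:
  assumes dom: "strict \<Longrightarrow> common_domain (\<A> \<union> (\<C> \<union> \<D>))"
    and \<phi>: "\<phi> \<in> FO \<tau> \<Q>" "fm_size \<phi> \<le> u" "separates_in_mode strict \<phi> \<A> \<C>"
    and \<psi>: "\<psi> \<in> FO \<tau> \<Q>" "fm_size \<psi> \<le> v" "separates_in_mode strict \<psi> \<A> \<D>"
  shows "separable_within (separates_in_mode strict) \<tau> \<Q> (u + v) \<A> (\<C> \<union> \<D>)"
proof -
  consider "\<A> \<union> \<C> = {}" | "\<A> \<union> \<D> = {}" | "\<A> \<union> \<C> \<noteq> {}" "\<A> \<union> \<D> \<noteq> {}" by blast
  then show ?thesis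
  proof cases
    case 1
    then show ?thesis using \<psi> unfolding separable_within_def by (intro bexI[of _ \<psi>]) auto
  next
    case 2
    then show ?thesis using \<phi> unfolding separable_within_def by (intro bexI[of _ \<phi>]) auto
  next
    case 3
    have fv: "free_vars (Conj \<phi> \<psi>) \<subseteq> dom f" if "strict" "(M, f) \<in> \<A> \<union> (\<C> \<union> \<D>)" for M f
    proof -
      obtain X where X: "\<And>M f. (M, f) \<in> \<A> \<union> (\<C> \<union> \<D>) \<Longrightarrow> dom f = X"
        using dom[OF \<open>strict\<close>] by (rule common_domainE) (rule that)
      obtain M1 f1 where 1: "(M1, f1) \<in> \<A> \<union> \<C>" using 3(1) by auto
      obtain M2 f2 where 2: "(M2, f2) \<in> \<A> \<union> \<D>" using 3(2) by auto
      have "free_vars \<phi> \<subseteq> dom f1" "free_vars \<psi> \<subseteq> dom f2"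
        using separates_in_modeD(1)[OF \<phi>(3) \<open>strict\<close> 1] separates_in_modeD(1)[OF \<psi>(3) \<open>strict\<close> 2] .
      moreover have "dom f1 = X" by (rule X[of M1]) (use 1 in blast)
      moreover have "dom f2 = X" by (rule X[of M2]) (use 2 in blast)
      moreover have "dom f = X" using that(2) by (rule X)
      ultimately show ?thesis by simp
    qed
    have "separates_in_mode strict (Conj \<phi> \<psi>) \<A> (\<C> \<union> \<D>)"
    proof (rule separates_in_modeI)
      show "sat M f (Conj \<phi> \<psi>)" if "(M, f) \<in> \<A>" for M f
        using separates_in_modeD(2)[OF \<phi>(3) that] separates_in_modeD(2)[OF \<psi>(3) that] by simp
      show "\<not> sat M f (Conj \<phi> \<psi>)" if "(M, f) \<in> \<C> \<union> \<D>" for M f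
        using that separates_in_modeD(3)[OF \<phi>(3)] separates_in_modeD(3)[OF \<psi>(3)] by fastforce
    qed (rule fv)
    then show ?thesis
      using \<phi> \<psi> unfolding separable_within_def by (intro bexI[of _ "Conj \<phi> \<psi>"]) (auto intro: FO.Conj)
  qed
qed

lemma dom_map_upds_respecting: "as \<in> respecting A xs \<Longrightarrow> dom (f(xs [\<mapsto>] as)) = dom f \<union> set xs"
  by (auto simp: respecting_def tuples_def)

lemma ran_map_upds_subset: "ran (f(xs [\<mapsto>] as)) \<subseteq> ran f \<union> set as"
proof
  fix y assume "y \<in> ran (f(xs [\<mapsto>] as))"
  then obtain x where "map_of (rev (zip xs as)) x = Some y \<or> f x = Some y"
    by (auto simp: ran_def map_upds_def map_add_Some_iff)
  then show "y \<in> ran f \<union> set as"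
    by (auto intro: ranI dest!: map_of_SomeD set_zip_rightD)
qed

lemma extension_in_pairs:
  assumes "(C, h) \<in> pairs \<tau>" and as: "as \<in> respecting (domain C) xs"
  shows "(C, h(xs [\<mapsto>] as)) \<in> pairs \<tau>"
proof -
  have "ran (h(xs [\<mapsto>] as)) \<subseteq> domain C"
    using assms ran_map_upds_subset[of h xs as]
    by (auto simp: pairs_def is_assignment_def respecting_def tuples_def)
  then show ?thesis
    using assms dom_map_upds_respecting[OF as, of h] by (simp add: pairs_def is_assignment_def)
qed

text \<open>Constant tuples respect all repetitions; they exist since domains are not empty.\<close>

lemma respecting_nonempty: "A \<noteq> {} \<Longrightarrow> \<exists>as. as \<in> respecting A xs"
proof -
  assume "A \<noteq> {}"
  then obtain a where "a \<in> A" by blast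
  then have "replicate (length xs) a \<in> respecting A xs"
    by (auto simp: respecting_def tuples_def respects_repetitions_def)
  then show ?thesis ..
qed

definition chosen_extensions ::
  "('a, 'r) pair set \<Rightarrow> var list \<Rightarrow> (('a, 'r) pair \<Rightarrow> 'a list set) \<Rightarrow> ('a, 'r) pair set" where
  "chosen_extensions \<C> xs P = {(C, h(xs [\<mapsto>] as)) | C h as. (C, h) \<in> \<C> \<and> as \<in> P (C, h)}"

definition rejected_extensions ::
  "('a, 'r) pair set \<Rightarrow> var list \<Rightarrow> (('a, 'r) pair \<Rightarrow> 'a list set) \<Rightarrow> ('a, 'r) pair set" where
  "rejected_extensions \<C> xs P =
     {(C, h(xs [\<mapsto>] as)) | C h as. (C, h) \<in> \<C> \<and> as \<in> respecting (domain C) xs - P (C, h)}"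

lemma successors_Supplement:
  "successors (s, \<A>, \<B>) (Supplement Q xss us Ps) =
     (\<lambda>j. (us ! j, chosen_extensions (\<A> \<union> \<B>) (xss ! j) (Ps ! j),
                   rejected_extensions (\<A> \<union> \<B>) (xss ! j) (Ps ! j))) ` {..<length Ps}"
  by (simp add: chosen_extensions_def rejected_extensions_def setcompr_eq_image lessThan_def)

lemma legal_Supplement:
  "legal \<Q> (s, \<A>, \<B>) (Supplement Q xss us Ps) \<longleftrightarrow>
     Q \<in> \<Q> \<and> map length xss = qtype Q \<and>
     length us = length (qtype Q) \<and> (\<forall>u \<in> set us. u \<ge> 1) \<and> sum_list us = s - 1 \<and>
     length Ps = length (qtype Q) \<and>
     (\<forall>j M f. j < length Ps \<longrightarrow> (M, f) \<in> \<A> \<union> \<B> \<longrightarrow>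
        (Ps ! j) (M, f) \<subseteq> respecting (domain M) (xss ! j)) \<and>
     (\<forall>M f. (M, f) \<in> \<A> \<longrightarrow> (domain M, map (\<lambda>P. P (M, f)) Ps) \<in> qclass Q) \<and>
     (\<forall>M f. (M, f) \<in> \<B> \<longrightarrow> (domain M, map (\<lambda>P. P (M, f)) Ps) \<notin> qclass Q)"
  by (simp add: Ball_def)

lemma extensionsI:
  assumes "(C, h) \<in> \<C>" and "as \<in> respecting (domain C) xs"
  shows "(C, h(xs [\<mapsto>] as)) \<in> chosen_extensions \<C> xs P \<union> rejected_extensions \<C> xs P"
proof (cases "as \<in> P (C, h)")
  case True
  with assms(1) have "(C, h(xs [\<mapsto>] as)) \<in> chosen_extensions \<C> xs P"
    unfolding chosen_extensions_def by fast
  then show ?thesis ..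
next
  case False
  with assms have "(C, h(xs [\<mapsto>] as)) \<in> rejected_extensions \<C> xs P"
    unfolding rejected_extensions_def by fast
  then show ?thesis ..
qed

lemma extensionsE:
  assumes "(M, g) \<in> chosen_extensions \<C> xs P \<union> rejected_extensions \<C> xs P"
    and "\<And>C h. (C, h) \<in> \<C> \<Longrightarrow> P (C, h) \<subseteq> respecting (domain C) xs"
  obtains h as where "(M, h) \<in> \<C>" "as \<in> respecting (domain M) xs" "g = h(xs [\<mapsto>] as)"
proof -
  obtain h as where "(M, h) \<in> \<C>" "as \<in> P (M, h) \<union> respecting (domain M) xs" "g = h(xs [\<mapsto>] as)"
    using assms(1) unfolding chosen_extensions_def rejected_extensions_def by blast
  then show ?thesis using that assms(2) by blast
qed

lemma extensions_in_pairs: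
  assumes "\<And>C h. (C, h) \<in> \<C> \<Longrightarrow> P (C, h) \<subseteq> respecting (domain C) xs" and "\<C> \<subseteq> pairs \<tau>"
  shows "chosen_extensions \<C> xs P \<union> rejected_extensions \<C> xs P \<subseteq> pairs \<tau>"
proof (rule subrelI)
  fix M g assume "(M, g) \<in> chosen_extensions \<C> xs P \<union> rejected_extensions \<C> xs P"
  then show "(M, g) \<in> pairs \<tau>"
    by (rule extensionsE) (use assms in \<open>blast intro: extension_in_pairs\<close>)+
qed

lemma common_domain_extensions:
  assumes P: "\<And>C h. (C, h) \<in> \<C> \<Longrightarrow> P (C, h) \<subseteq> respecting (domain C) xs" and "common_domain \<C>"
  shows "common_domain (chosen_extensions \<C> xs P \<union> rejected_extensions \<C> xs P)"
proof -
  obtain X where X: "\<And>M f. (M, f) \<in> \<C> \<Longrightarrow> dom f = X"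
    using assms(2) by (rule common_domainE) (rule that)
  have "dom g = X \<union> set xs"
    if "(M, g) \<in> chosen_extensions \<C> xs P \<union> rejected_extensions \<C> xs P" for M g
    using that
  proof (rule extensionsE)
    show "dom g = X \<union> set xs"
      if "(M, h) \<in> \<C>" "as \<in> respecting (domain M) xs" "g = h(xs [\<mapsto>] as)" for h as
      using X[OF that(1)] dom_map_upds_respecting[OF that(2), of h] that(3) by simp
  qed (rule P)
  then show ?thesis by (rule common_domainI)
qed

lemma chosen_set_definable:
  assumes "separates \<phi> (chosen_extensions \<C> xs P) (rejected_extensions \<C> xs P)"
    and "(M, f) \<in> \<C>" and "P (M, f) \<subseteq> respecting (domain M) xs"
  shows "{as \<in> respecting (domain M) xs. sat M (f(xs [\<mapsto>] as)) \<phi>} = P (M, f)"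
proof -
  have "sat M (f(xs [\<mapsto>] as)) \<phi> \<longleftrightarrow> as \<in> P (M, f)" if "as \<in> respecting (domain M) xs" for as
  proof (cases "as \<in> P (M, f)")
    case True
    then have "(M, f(xs [\<mapsto>] as)) \<in> chosen_extensions \<C> xs P"
      using assms(2) unfolding chosen_extensions_def by fast
    then have "sat M (f(xs [\<mapsto>] as)) \<phi>" using assms(1) unfolding separates_iff by fast
    with True show ?thesis by simp
  next
    case False
    then have "(M, f(xs [\<mapsto>] as)) \<in> rejected_extensions \<C> xs P"
      using assms(2) that unfolding rejected_extensions_def by fast
    then have "\<not> sat M (f(xs [\<mapsto>] as)) \<phi>" using assms(1) unfolding separates_iff by fast
    with False show ?thesis by simp
  qed
  then show ?thesis using assms(3) by blast
qed

text \<open>Since every pair has an extension, the free variables of \<open>\<phi>\<close> are controlled by the successor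
position as soon as there is a pair at all.\<close>

lemma free_vars_if_separates_extensions:
  assumes "\<forall>M f. (M, f) \<in> chosen_extensions \<C> xs P \<union> rejected_extensions \<C> xs P \<longrightarrow>
      free_vars \<phi> \<subseteq> dom f"
    and "(M, f) \<in> \<C>" and "\<C> \<subseteq> pairs \<tau>"
  shows "free_vars \<phi> - set xs \<subseteq> dom f"
proof -
  have "domain M \<noteq> {}" using assms(2,3) by (auto simp: pairs_def is_model_def)
  then obtain as where as: "as \<in> respecting (domain M) xs"
    by (metis respecting_nonempty)
  have "free_vars \<phi> \<subseteq> dom (f(xs [\<mapsto>] as))"
    using assms(1) extensionsI[OF assms(2) as] by metis
  then show ?thesis unfolding dom_map_upds_respecting[OF as] by (simp add: Diff_subset_conv Un_commute)
qed

lemma separable_supplement: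
  assumes legal: "legal \<Q> (s, \<A>, \<B>) (Supplement Q xss us Ps)" and "1 \<le> s"
    and AB: "\<A> \<union> \<B> \<subseteq> pairs \<tau>"
    and ex: "\<And>j. j < length Ps \<Longrightarrow> separable_within (separates_in_mode strict) \<tau> \<Q> (us ! j)
      (chosen_extensions (\<A> \<union> \<B>) (xss ! j) (Ps ! j))
      (rejected_extensions (\<A> \<union> \<B>) (xss ! j) (Ps ! j))"
  shows "separable_within (separates_in_mode strict) \<tau> \<Q> s \<A> \<B>"
proof -
  let ?k = "length Ps"
  from legal[unfolded legal_Supplement] have Q: "Q \<in> \<Q>" and xss: "map length xss = qtype Q"
    and us: "length us = ?k" "sum_list us = s - 1" and k: "length (qtype Q) = ?k"
    and P: "\<And>j M f. j < ?k \<Longrightarrow> (M, f) \<in> \<A> \<union> \<B> \<Longrightarrow>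
      (Ps ! j) (M, f) \<subseteq> respecting (domain M) (xss ! j)"
    and PA: "\<And>M f. (M, f) \<in> \<A> \<Longrightarrow> (domain M, map (\<lambda>P. P (M, f)) Ps) \<in> qclass Q"
    and PB: "\<And>M f. (M, f) \<in> \<B> \<Longrightarrow> (domain M, map (\<lambda>P. P (M, f)) Ps) \<notin> qclass Q"
    by (simp_all del: Un_iff)
  have lx: "length xss = ?k" using xss k by (metis length_map)
  obtain \<phi> where \<phi>: "\<And>j. j < ?k \<Longrightarrow> \<phi> j \<in> FO \<tau> \<Q> \<and> fm_size (\<phi> j) \<le> us ! j \<and>
      separates_in_mode strict (\<phi> j) (chosen_extensions (\<A> \<union> \<B>) (xss ! j) (Ps ! j))
        (rejected_extensions (\<A> \<union> \<B>) (xss ! j) (Ps ! j))"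
    using ex unfolding separable_within_def by metis
  define bs where "bs = map (\<lambda>j. (xss ! j, \<phi> j)) [0..<?k]"
  have "Quant Q bs \<in> FO \<tau> \<Q>"
  proof (rule FO.Quant[OF Q])
    show "map (length \<circ> fst) bs = qtype Q"
      unfolding bs_def xss[symmetric] by (rule nth_equalityI) (auto simp: lx)
    show "\<psi> \<in> FO \<tau> \<Q>" if "(xs, \<psi>) \<in> set bs" for xs \<psi>
      using that \<phi> by (auto simp: bs_def)
  qed
  moreover have "fm_size (Quant Q bs) \<le> s"
  proof -
    have "sum_list (map (\<lambda>(xs, \<phi>). fm_size \<phi>) bs) = sum_list (map (\<lambda>j. fm_size (\<phi> j)) [0..<?k])"
      by (simp add: bs_def comp_def)
    also have "\<dots> \<le> sum_list (map ((!) us) [0..<?k])"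
      by (rule sum_list_mono) (use \<phi> in auto)
    also have "\<dots> = s - 1" using us map_nth[of us] by simp
    finally show ?thesis using \<open>1 \<le> s\<close> by simp
  qed
  moreover have "separates_in_mode strict (Quant Q bs) \<A> \<B>"
  proof -
    have eq: "map (\<lambda>(xs, \<phi>). {as \<in> respecting (domain M) xs. sat M (f(xs [\<mapsto>] as)) \<phi>}) bs
        = map (\<lambda>P. P (M, f)) Ps" if "(M, f) \<in> \<A> \<union> \<B>" for M f
    proof (rule nth_equalityI)
      fix j assume "j < length (map (\<lambda>(xs, \<phi>).
        {as \<in> respecting (domain M) xs. sat M (f(xs [\<mapsto>] as)) \<phi>}) bs)"
      then have j: "j < ?k" by (simp add: bs_def)
      have "separates (\<phi> j) (chosen_extensions (\<A> \<union> \<B>) (xss ! j) (Ps ! j))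
        (rejected_extensions (\<A> \<union> \<B>) (xss ! j) (Ps ! j))"
        using \<phi>[OF j] unfolding separates_in_mode_def by blast
      from chosen_set_definable[OF this that P[OF j that]]
      show "map (\<lambda>(xs, \<phi>). {as \<in> respecting (domain M) xs. sat M (f(xs [\<mapsto>] as)) \<phi>}) bs ! j
        = map (\<lambda>P. P (M, f)) Ps ! j"
        using j by (simp add: bs_def)
    qed (simp add: bs_def)
    have "free_vars (Quant Q bs) \<subseteq> dom f" if "strict" "(M, f) \<in> \<A> \<union> \<B>" for M f
    proof -
      have "free_vars (\<phi> j) - set (xss ! j) \<subseteq> dom f" if "j < ?k" for j
        using \<phi>[OF that] \<open>strict\<close> unfolding separates_in_mode_iff
        by (intro free_vars_if_separates_extensions[OF _ \<open>(M, f) \<in> \<A> \<union> \<B>\<close> AB, of "xss ! j" "Ps ! j"])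
          blast
      then show ?thesis by (simp add: bs_def UN_subset_iff)
    qed
    moreover have "separates (Quant Q bs) \<A> \<B>"
      using eq PA PB by (auto simp: separates_iff simp del: map_map)
    ultimately show ?thesis unfolding separates_in_mode_iff by blast
  qed
  ultimately show ?thesis unfolding separable_within_def by blast
qed

lemma separable_if_winning_position:
  assumes "winning_position (separates_in_mode strict) \<tau> \<Q> (s, \<A>, \<B>)"
    and "1 \<le> s" and "\<A> \<union> \<B> \<subseteq> pairs \<tau>" and "strict \<Longrightarrow> common_domain (\<A> \<union> \<B>)"
  shows "separable_within (separates_in_mode strict) \<tau> \<Q> s \<A> \<B>"
  using assms
proof (induction "(s, \<A>, \<B>)" arbitrary: s \<A> \<B> rule: winning_position.induct)
  case won
  then show ?case by (intro separable_if_won_by_I)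
next
  case (move m)
  let ?sep = "separates_in_mode strict"
  show ?case
  proof (cases "won_by_I ?sep \<tau> (s, \<A>, \<B>)")
    case True
    then show ?thesis using move.prems(1) by (rule separable_if_won_by_I)
  next
    case False
    then have s: "2 \<le> s" using fst_ge_2_if_not_over[OF False move.hyps(1)] move.prems(1) by simp
    show ?thesis
    proof (cases m)
      case Swap
      have "separable_within ?sep \<tau> \<Q> (s - 1) \<B> \<A>"
        using move.hyps(4)[of "s - 1" \<B> \<A>] Swap s move.prems by (simp add: Un_commute)
      then obtain \<phi> where "\<phi> \<in> FO \<tau> \<Q>" "fm_size \<phi> \<le> s - 1" "?sep \<phi> \<B> \<A>"
        unfolding separable_within_def by blast
      then show ?thesis using s unfolding separable_within_def
        by (intro bexI[of _ "Neg \<phi>"]) (auto intro: FO.Neg simp: separates_Neg)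
    next
      case (Split u v \<C> \<D>)
      then have uv: "1 \<le> u" "1 \<le> v" "s = u + v" "\<B> = \<C> \<union> \<D>" using move.hyps(2) by auto
      have dom: "common_domain (\<A> \<union> \<C>)" "common_domain (\<A> \<union> \<D>)" if "strict"
        using common_domain_subset[OF move.prems(3)[OF that]] uv(4) by blast+
      have "separable_within ?sep \<tau> \<Q> u \<A> \<C>" "separable_within ?sep \<tau> \<Q> v \<A> \<D>"
        using move.hyps(4)[of u \<A> \<C>] move.hyps(4)[of v \<A> \<D>] Split uv move.prems(2) dom by auto
      then show ?thesis using separable_split move.prems(3)
        unfolding uv(3,4) separable_within_def[of _ _ _ u] separable_within_def[of _ _ _ v] by blast
    next
      case (Supplement Q xss us Ps)
      have legal: "legal \<Q> (s, \<A>, \<B>) (Supplement Q xss us Ps)"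
        using move.hyps(2) Supplement by simp
      show ?thesis
      proof (rule separable_supplement[OF legal move.prems(1,2)])
        fix j assume j: "j < length Ps"
        let ?P = "chosen_extensions (\<A> \<union> \<B>) (xss ! j) (Ps ! j)"
        let ?N = "rejected_extensions (\<A> \<union> \<B>) (xss ! j) (Ps ! j)"
        have P: "(Ps ! j) (C, h) \<subseteq> respecting (domain C) (xss ! j)"
          if "(C, h) \<in> \<A> \<union> \<B>" for C h
          using legal[unfolded legal_Supplement] j that by (simp del: Un_iff)
        have u: "1 \<le> us ! j" using legal[unfolded legal_Supplement] j by simp
        have "(us ! j, ?P, ?N) \<in> successors (s, \<A>, \<B>) m"
          unfolding Supplement successors_Supplement using j by blast
        then show "separable_within ?sep \<tau> \<Q> (us ! j) ?P ?N"
          using u extensions_in_pairs[OF P move.prems(2)]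
            common_domain_extensions[OF P move.prems(3)] by (rule move.hyps(4))
      qed
    qed
  qed
qed

section \<open>From formulas to winning positions\<close>

text \<open>The moves are dictated by the formula: a splitting sorts \<open>\<B>\<close> by the conjunct that fails, and
a supplementing takes for \<open>P\<^sub>j\<close> the set defined by the \<open>j\<close>-th subformula. Subformula sizes may
sum to less than the available number, whereas moves must use it up exactly; the surplus goes
to the second conjunct or to the first subformula under the quantifier, which exists because
the width is positive.\<close>

lemma winning_position_if_separates:
  assumes "\<phi> \<in> FO \<tau> \<Q>" and Q: "\<forall>Q \<in> \<Q>. is_quantifier Q"
    and "fm_size \<phi> \<le> s" and "separates_in_mode strict \<phi> \<A> \<B>"
  shows "winning_position (separates_in_mode strict) \<tau> \<Q> (s, \<A>, \<B>)"
  using assms(1,3,4)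
proof (induction arbitrary: s \<A> \<B> rule: FO.induct)
  case (Eq x y)
  then show ?case by (intro winning_position.won) (auto intro!: bexI[of _ "Eq x y"] FO.Eq)
next
  case (Rel R xs)
  then show ?case by (intro winning_position.won) (auto intro!: bexI[of _ "Rel R xs"] FO.Rel)
next
  case (Neg \<phi>)
  have "1 \<le> fm_size \<phi>" by (rule fm_size_ge_1)
  moreover have "separates_in_mode strict \<phi> \<B> \<A>"
    using Neg.prems(2) by (simp add: separates_Neg)
  ultimately have "winning_position (separates_in_mode strict) \<tau> \<Q> (s - 1, \<B>, \<A>)" "s \<noteq> 1"
    using Neg.IH Neg.prems(1) by simp_all
  then show ?case by (intro winning_position.move[of _ _ "(s, \<A>, \<B>)" _ Swap]) simp_all
next
  case (Conj \<phi> \<psi>)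
  define \<C> where "\<C> = {(M, f) \<in> \<B>. \<not> sat M f \<phi>}"
  define \<D> where "\<D> = {(M, f) \<in> \<B>. \<not> sat M f \<psi>}"
  have size: "1 \<le> fm_size \<phi>" "1 \<le> fm_size \<psi>" by (rule fm_size_ge_1)+
  have B: "\<C> \<union> \<D> = \<B>"
    using separates_in_modeD(3)[OF Conj.prems(2)] by (auto simp: \<C>_def \<D>_def)
  have "separates_in_mode strict \<phi> \<A> \<C>" "separates_in_mode strict \<psi> \<A> \<D>"
    using Conj.prems(2) by (simp_all add: \<C>_def \<D>_def separates_in_mode_iff separates_iff) meson+
  then have "winning_position (separates_in_mode strict) \<tau> \<Q> (fm_size \<phi>, \<A>, \<C>)"
    "winning_position (separates_in_mode strict) \<tau> \<Q> (s - fm_size \<phi>, \<A>, \<D>)"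
    using Conj.IH Conj.prems(1) by simp_all
  moreover have "legal \<Q> (s, \<A>, \<B>) (Split (fm_size \<phi>) (s - fm_size \<phi>) \<C> \<D>)"
    using size B Conj.prems(1) by simp
  ultimately show ?case
    using size Conj.prems(1)
    by (intro winning_position.move[of _ _ "(s, \<A>, \<B>)" _
          "Split (fm_size \<phi>) (s - fm_size \<phi>) \<C> \<D>"]) auto
next
  case (Quant Q bs)
  have "is_quantifier Q" using Q Quant.hyps(1) by blast
  then have "bs \<noteq> []" using Quant.hyps(2) by (auto simp: is_quantifier_def)
  define us where
    "us = (let ns = map (fm_size \<circ> snd) bs in (s - 1 - sum_list (tl ns)) # tl ns)"
  define Ps where "Ps = map (\<lambda>(xs, \<phi>) (M, f).
    {as \<in> respecting (domain M) xs. sat M (f(xs [\<mapsto>] as)) \<phi>}) bs"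
  let ?m = "Supplement Q (map fst bs) us Ps"
  have size: "sum_list (map (fm_size \<circ> snd) bs) + 1 \<le> s"
    using Quant.prems(1) by (simp add: split_def comp_def)
  have us: "length us = length bs" "sum_list us = s - 1"
    "\<And>j. j < length bs \<Longrightarrow> fm_size (snd (bs ! j)) \<le> us ! j"
    using \<open>bs \<noteq> []\<close> size by (cases bs; auto simp: us_def Let_def nth_Cons split: nat.split)+
  have us1: "\<forall>u \<in> set us. 1 \<le> u"
  proof
    fix u assume "u \<in> set us"
    then obtain j where "j < length bs" "u = us ! j" using us(1) by (auto simp: in_set_conv_nth)
    then show "1 \<le> u" using us(3)[of j] fm_size_ge_1[of "snd (bs ! j)"] by simp
  qed
  have len: "length Ps = length bs" "length (qtype Q) = length bs"
    using Quant.hyps(2) by (auto simp: Ps_def simp flip: Quant.hyps(2))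
  have val: "map (\<lambda>P. P (M, f)) Ps =
      map (\<lambda>(xs, \<phi>). {as \<in> respecting (domain M) xs. sat M (f(xs [\<mapsto>] as)) \<phi>}) bs" for M f
    by (simp add: Ps_def split_def comp_def)
  have nth: "(Ps ! j) (M, f) =
      {as \<in> respecting (domain M) (fst (bs ! j)). sat M (f(fst (bs ! j) [\<mapsto>] as)) (snd (bs ! j))}"
    if "j < length bs" for j M f
    using that by (simp add: Ps_def case_prod_beta)
  have sep: "separates (Quant Q bs) \<A> \<B>"
    using Quant.prems(2) unfolding separates_in_mode_def by blast
  have legal: "legal \<Q> (s, \<A>, \<B>) ?m"
  proof -
    have "map length (map fst bs) = qtype Q" using Quant.hyps(2) by simp
    moreover have "(domain M, map (\<lambda>P. P (M, f)) Ps) \<in> qclass Q" if "(M, f) \<in> \<A>" for M f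
      using sep that unfolding separates_iff val by auto
    moreover have "(domain M, map (\<lambda>P. P (M, f)) Ps) \<notin> qclass Q" if "(M, f) \<in> \<B>" for M f
      using sep that unfolding separates_iff val by auto
    ultimately show ?thesis
      using Quant.hyps(1) us us1 len nth unfolding legal_Supplement by simp
  qed
  have "s \<noteq> 1"
  proof -
    have "1 \<le> sum_list us"
      using us1 us(1) \<open>bs \<noteq> []\<close> by (cases us) auto
    then show ?thesis using us(2) by simp
  qed
  then have nII: "\<not> won_by_II (separates_in_mode strict) \<tau> (s, \<A>, \<B>)" by simp
  show ?case
  proof (rule winning_position.move[OF nII legal])
    fix q assume "q \<in> successors (s, \<A>, \<B>) ?m"
    then obtain j where j: "j < length bs"
      and q: "q = (us ! j, chosen_extensions (\<A> \<union> \<B>) (map fst bs ! j) (Ps ! j),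
        rejected_extensions (\<A> \<union> \<B>) (map fst bs ! j) (Ps ! j))"
      unfolding successors_Supplement len by blast
    obtain xs \<phi> where b: "bs ! j = (xs, \<phi>)" by (cases "bs ! j")
    have mem: "(xs, \<phi>) \<in> set bs" using j b by (metis nth_mem)
    have Pj: "(Ps ! j) (M, f) = {as \<in> respecting (domain M) xs. sat M (f(xs [\<mapsto>] as)) \<phi>}" for M f
      using nth[OF j] b by simp
    have "free_vars \<phi> \<subseteq> dom g"
      if "strict" and g: "(M, g) \<in> chosen_extensions (\<A> \<union> \<B>) xs (Ps ! j) \<union>
        rejected_extensions (\<A> \<union> \<B>) xs (Ps ! j)" for M g
    proof -
      obtain h as where h: "(M, h) \<in> \<A> \<union> \<B>" "as \<in> respecting (domain M) xs" "g = h(xs [\<mapsto>] as)"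
        using g by (rule extensionsE) (auto simp: Pj)
      have "free_vars (Quant Q bs) \<subseteq> dom h"
        using separates_in_modeD(1)[OF Quant.prems(2) \<open>strict\<close> h(1)] .
      moreover have "free_vars \<phi> - set xs \<subseteq> free_vars (Quant Q bs)" using mem by force
      ultimately have "free_vars \<phi> - set xs \<subseteq> dom h" by (rule order_trans[rotated])
      then show ?thesis
        using h(3) dom_map_upds_respecting[OF h(2), of h] by (simp add: Diff_subset_conv Un_commute)
    qed
    moreover have "separates \<phi> (chosen_extensions (\<A> \<union> \<B>) xs (Ps ! j))
        (rejected_extensions (\<A> \<union> \<B>) xs (Ps ! j))"
      by (auto simp: separates_iff chosen_extensions_def rejected_extensions_def Pj)
    ultimately have "separates_in_mode strict \<phi> (chosen_extensions (\<A> \<union> \<B>) xs (Ps ! j))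
        (rejected_extensions (\<A> \<union> \<B>) xs (Ps ! j))"
      unfolding separates_in_mode_iff by blast
    moreover have "fm_size \<phi> \<le> us ! j" using us(3)[OF j] b by simp
    ultimately show "winning_position (separates_in_mode strict) \<tau> \<Q> q"
      unfolding q using Quant.IH[OF mem] j b by simp
  qed
qed

lemma winning_strategy_iff_separable:
  assumes "\<forall>Q \<in> \<Q>. is_quantifier Q" and "\<A> \<subseteq> pairs \<tau>" and "\<B> \<subseteq> pairs \<tau>" and "1 \<le> s"
    and "strict \<Longrightarrow> common_domain (\<A> \<union> \<B>)"
  shows "(\<exists>\<sigma>. winning_strategy (separates_in_mode strict) \<tau> \<Q> (s, \<A>, \<B>) \<sigma>) \<longleftrightarrow>
    separable_within (separates_in_mode strict) \<tau> \<Q> s \<A> \<B>"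
proof -
  have "winning_position (separates_in_mode strict) \<tau> \<Q> (s, \<A>, \<B>)"
    if "separable_within (separates_in_mode strict) \<tau> \<Q> s \<A> \<B>"
    using that winning_position_if_separates[OF _ assms(1)] unfolding separable_within_def by blast
  moreover have "separable_within (separates_in_mode strict) \<tau> \<Q> s \<A> \<B>"
    if "winning_position (separates_in_mode strict) \<tau> \<Q> (s, \<A>, \<B>)"
    using separable_if_winning_position[OF that] assms by blast
  ultimately show ?thesis using winning_strategy_iff[OF assms(1)] assms(4) by (metis fst_conv)
qed

theorem theoremA4:
  fixes \<tau> :: "'r vocabulary" and \<Q> :: "'a quantifier set"
    and \<A> \<B> :: "('a, 'r) pair set" and s :: nat
  assumes "finite (dom \<tau>)"
    and "finite \<Q>" and "\<forall>Q \<in> \<Q>. is_quantifier Q"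
    and "\<A> \<subseteq> pairs \<tau>" and "\<B> \<subseteq> pairs \<tau>"
    and "s \<ge> 1"
  shows "((\<exists>\<sigma>. winning_strategy separates \<tau> \<Q> (s, \<A>, \<B>) \<sigma>) \<longleftrightarrow>
            separable_within separates \<tau> \<Q> s \<A> \<B>) \<and>
         (common_domain (\<A> \<union> \<B>) \<longrightarrow>
           ((\<exists>\<sigma>. winning_strategy separates_strictly \<tau> \<Q> (s, \<A>, \<B>) \<sigma>) \<longleftrightarrow>
              separable_within separates_strictly \<tau> \<Q> s \<A> \<B>))"
  unfolding separates_eq_mode separates_strictly_eq_mode
  using winning_strategy_iff_separable[OF assms(3-6), of False]
    winning_strategy_iff_separable[OF assms(3-6), of True] by blast

end
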